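(* Let $S$ be a subsemigroup of $((0,\infty),+)$ which is dense in $(0,\infty)$. Let $B$ be an $\alpha\times\delta$ matrix which is image partition regular near zero over $S$ and let $M\in\mathcal M_0(S)$ be a $\gamma\times\mu$ matrix. Then the matrix $\begin{pmatrix}\bar 1&B&0\\\bar 0&0&M\end{pmatrix}$ is image partition regular near zero over $S$, where $\bar 1$ is the $\alpha\times 1$ column with all entries $1$ and $\bar 0$ is the $\gamma\times1$ zero column.
   Context: Matrices have rows and columns indexed by positive countable ordinals. A matrix is admissible if its entries are rational, no row is $\vec 0$, and each row has finitely many nonzero entries. An admissible $\alpha\times\delta$ matrix $N$ is image partition regular near zero over $S$ if whenever $S$ is finitely colored and $\varepsilon>0$ there is $\vec x\in S^\delta$ with the entries of $N\vec x$ monochromatic and lying in $(-\varepsilon,\varepsilon)$. $\beta S$ is the set of ultrafilters on $S$, with $B\in p+q$ iff $\{x\in S:-x+B\in q\}\in p$; $\overline C=\{p\in\beta S:C\in p\}$. $O^+(S)=\{p\in\beta S:(0,\varepsilon)\cap S\in p$ for all $\varepsilon>0\}$. $T\subseteq S$ is thick near zero if $L\subseteq\overline T$ for some left ideal $L$ of $O^+(S)$. $\mathcal M_0(S)$ is the set of admissible matrices $M$ (of size $\gamma\times\mu$) such that whenever $T$ is thick near zero in $S$ and finitely colored, there is $\vec x\in S^\mu$ with all entries of $M\vec x$ in one color class of $T$. *)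

theory Defs
  imports "HOL-Analysis.Analysis"
begin

subsection \<open>Matrices\<close>

text \<open>
  A positive countable ordinal serves here only as a nonempty countable index set, so the rows and
  the columns of a matrix are indexed by types of class \<^class>\<open>countable\<close>.  The ordinal sum of two
  index sets becomes the sum of the two types, and \<^typ>\<open>unit\<close> indexes a single column.
\<close>

definition admissible :: "('r::countable \<Rightarrow> 'c::countable \<Rightarrow> real) \<Rightarrow> bool" where
  "admissible N \<longleftrightarrow>
     (\<forall>i j. N i j \<in> \<rat>) \<and>
     (\<forall>i. \<exists>j. N i j \<noteq> 0) \<and>
     (\<forall>i. finite {j. N i j \<noteq> 0})"

text \<open>For an admissible matrix the sum runs over a finite set.\<close>

definition mat_vec :: "('r \<Rightarrow> 'c \<Rightarrow> real) \<Rightarrow> ('c \<Rightarrow> real) \<Rightarrow> 'r \<Rightarrow> real" where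
  "mat_vec N x i = (\<Sum>j | N i j \<noteq> 0. N i j * x j)"

fun block_matrix ::
  "('a \<Rightarrow> 'd \<Rightarrow> real) \<Rightarrow> ('g \<Rightarrow> 'm \<Rightarrow> real) \<Rightarrow> 'a + 'g \<Rightarrow> unit + 'd + 'm \<Rightarrow> real"
where
  "block_matrix B M (Inl i) (Inl _)       = 1"
| "block_matrix B M (Inl i) (Inr (Inl j)) = B i j"
| "block_matrix B M (Inl i) (Inr (Inr k)) = 0"
| "block_matrix B M (Inr l) (Inl _)       = 0"
| "block_matrix B M (Inr l) (Inr (Inl j)) = 0"
| "block_matrix B M (Inr l) (Inr (Inr k)) = M l k"

text \<open>
  A finite colouring of \<open>T\<close> is a function \<open>\<phi>\<close> with finite range on \<open>T\<close>; the colour classes are the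
  sets \<open>{t \<in> T. \<phi> t = c}\<close>.  Being monochromatic includes membership in \<open>T\<close>, because values of
  \<open>\<phi>\<close> outside \<open>T\<close> are meaningless.
\<close>

definition finite_colouring :: "(real \<Rightarrow> nat) \<Rightarrow> real set \<Rightarrow> bool" where
  "finite_colouring \<phi> T \<longleftrightarrow> finite (\<phi> ` T)"

definition monochromatic :: "(real \<Rightarrow> nat) \<Rightarrow> real set \<Rightarrow> ('r \<Rightarrow> real) \<Rightarrow> bool" where
  "monochromatic \<phi> T v \<longleftrightarrow> (\<exists>c. \<forall>i. v i \<in> {t \<in> T. \<phi> t = c})"

definition ipr_near_zero ::
  "real set \<Rightarrow> ('r::countable \<Rightarrow> 'c::countable \<Rightarrow> real) \<Rightarrow> bool"
where
  "ipr_near_zero S N \<longleftrightarrow>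
     admissible N \<and>
     (\<forall>\<phi> \<epsilon>. finite_colouring \<phi> S \<and> \<epsilon> > 0 \<longrightarrow>
        (\<exists>x. (\<forall>j. x j \<in> S) \<and> monochromatic \<phi> S (mat_vec N x) \<and>
             (\<forall>i. mat_vec N x i \<in> {-\<epsilon><..<\<epsilon>})))"

subsection \<open>Ultrafilters on a semigroup of reals\<close>

definition beta :: "real set \<Rightarrow> real set set set" where
  "beta S = {p. p \<subseteq> Pow S \<and> S \<in> p \<and> {} \<notin> p \<and>
               (\<forall>A\<in>p. \<forall>B\<in>p. A \<inter> B \<in> p) \<and>
               (\<forall>A\<in>p. \<forall>B. A \<subseteq> B \<and> B \<subseteq> S \<longrightarrow> B \<in> p) \<and>
               (\<forall>A. A \<subseteq> S \<longrightarrow> A \<in> p \<or> S - A \<in> p)}"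

text \<open>The inner set is \<open>-x + B\<close>, computed inside \<open>S\<close>.\<close>

definition uf_plus :: "real set \<Rightarrow> real set set \<Rightarrow> real set set \<Rightarrow> real set set" where
  "uf_plus S p q = {B. B \<subseteq> S \<and> {x \<in> S. {y \<in> S. x + y \<in> B} \<in> q} \<in> p}"

definition uf_closure :: "real set \<Rightarrow> real set \<Rightarrow> real set set set" where
  "uf_closure S C = {p \<in> beta S. C \<in> p}"

definition O_plus :: "real set \<Rightarrow> real set set set" where
  "O_plus S = {p \<in> beta S. \<forall>\<epsilon>>0. {0<..<\<epsilon>} \<inter> S \<in> p}"

text \<open>As usual, ideals of a semigroup are nonempty.\<close>

definition left_ideal :: "('s \<Rightarrow> 's \<Rightarrow> 's) \<Rightarrow> 's set \<Rightarrow> 's set \<Rightarrow> bool" where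
  "left_ideal f X L \<longleftrightarrow> L \<noteq> {} \<and> L \<subseteq> X \<and> (\<forall>p\<in>X. \<forall>q\<in>L. f p q \<in> L)"

definition thick_near_zero :: "real set \<Rightarrow> real set \<Rightarrow> bool" where
  "thick_near_zero S T \<longleftrightarrow>
     T \<subseteq> S \<and> (\<exists>L. left_ideal (uf_plus S) (O_plus S) L \<and> L \<subseteq> uf_closure S T)"

definition M0 :: "real set \<Rightarrow> ('r::countable \<Rightarrow> 'c::countable \<Rightarrow> real) set" where
  "M0 S = {M. admissible M \<and>
     (\<forall>T \<phi>. thick_near_zero S T \<and> finite_colouring \<phi> T \<longrightarrow>
        (\<exists>x. (\<forall>j. x j \<in> S) \<and> monochromatic \<phi> T (mat_vec M x)))}"

end

theory Submission
  imports Defs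
begin

text \<open>
  Given a colouring of \<open>S\<close> and \<open>\<epsilon> > 0\<close>, call a colour good if some \<open>x\<^sub>0 + B x\<close> lies in its class below
  \<open>\<epsilon>\<close>, and let \<open>T\<close> be the set of points of \<open>S\<close> below \<open>\<epsilon>\<close> with a good colour.  If \<open>T\<close> is thick near
  zero, then \<open>M\<close> has an image inside one good class and we are done.  Otherwise, by compactness,
  there are a finite set \<open>F\<close> of small elements and \<open>\<delta> > 0\<close> such that every \<open>y \<in> S\<close> below \<open>\<delta>\<close> has a
  translate \<open>t + y \<notin> T\<close> with \<open>t \<in> F\<close>.  Colouring \<open>y\<close> by \<open>t\<close> together with the colour of \<open>t + y\<close>,
  the regularity of \<open>B\<close> yields a translate \<open>t + B x\<close> inside one class that is not good, which is
  absurd.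
\<close>

subsection \<open>Ultrafilters\<close>

text \<open>The finite intersection property inside \<open>S\<close>. Intersecting with
  \<open>S\<close> makes the empty family contribute \<open>S\<close> itself, so the property also
  forces \<open>S\<close> to be nonempty.\<close>

definition fip :: "'a set \<Rightarrow> 'a set set \<Rightarrow> bool" where
  "fip S H \<longleftrightarrow> H \<subseteq> Pow S \<and> (\<forall>F. finite F \<and> F \<subseteq> H \<longrightarrow> S \<inter> \<Inter>F \<noteq> {})"

text \<open>A finite subfamily of the union of a chain already lies in one member of the chain. This
  supplies the upper bounds for Zorn's lemma.\<close>

lemma fip_Union_chain:
  assumes "subset.chain {H. fip S H} C" "C \<noteq> {}"
  shows "fip S (\<Union>C)"
  unfolding fip_def
proof (intro conjI allI impI)
  show "\<Union>C \<subseteq> Pow S"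
    using assms(1) unfolding subset.chain_def fip_def by blast
  fix F assume F: "finite F \<and> F \<subseteq> \<Union>C"
  then obtain H where H: "H \<in> C" "F \<subseteq> H"
    using finite_subset_Union_chain[OF _ _ assms(2,1)] by metis
  have "fip S H" using assms(1) H(1) unfolding subset.chain_def by auto
  then show "S \<inter> \<Inter>F \<noteq> {}" using F H(2) unfolding fip_def by simp
qed

text \<open>By maximality, a subset of \<open>S\<close> outside \<open>U\<close> must be disjoint
  from some finite intersection of members of \<open>U\<close>, since otherwise it could be added.
  Hence every subset of \<open>S\<close> containing a finite intersection is in \<open>U\<close>,
  and the ultrafilter axioms follow.\<close>

lemma maximal_fip_in_beta:
  assumes U: "fip S U" and max: "\<And>H. fip S H \<Longrightarrow> U \<subseteq> H \<Longrightarrow> H = U"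
  shows "U \<in> beta S"
proof -
  have meets: "S \<inter> \<Inter>F \<noteq> {}" if "finite F" "F \<subseteq> U" for F
    using U that unfolding fip_def by blast
  have sub: "U \<subseteq> Pow S" using U unfolding fip_def by blast
  have avoid: "\<exists>F. finite F \<and> F \<subseteq> U \<and> S \<inter> A \<inter> \<Inter>F = {}" if "A \<subseteq> S" "A \<notin> U" for A
  proof -
    have "\<not> fip S (insert A U)" using max[of "insert A U"] that(2) by blast
    moreover have "insert A U \<subseteq> Pow S" using sub that(1) by simp
    ultimately obtain F where F: "finite F" "F \<subseteq> insert A U" "S \<inter> \<Inter>F = {}"
      unfolding fip_def by metis
    \<comment> \<open>The witness \<open>F\<close> may or may not contain \<open>A\<close>;
      adjoining \<open>A\<close> only shrinks the intersection, so both cases are treated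
      alike.\<close>
    have "S \<inter> \<Inter>(insert A (F - {A})) \<subseteq> S \<inter> \<Inter>F" by (intro Int_mono Inter_anti_mono) auto
    then have "S \<inter> A \<inter> \<Inter>(F - {A}) = {}" using F(3) unfolding Inter_insert Int_assoc by simp
    moreover have "finite (F - {A})" "F - {A} \<subseteq> U" using F(1,2) by auto
    ultimately show ?thesis by blast
  qed
  have memI: "A \<in> U" if G: "A \<subseteq> S" "finite G" "G \<subseteq> U" "S \<inter> \<Inter>G \<subseteq> A" for A G
  proof (rule ccontr)
    assume "A \<notin> U"
    then obtain F where F: "finite F" "F \<subseteq> U" "S \<inter> A \<inter> \<Inter>F = {}"
      using avoid[OF G(1)] \<open>A \<notin> U\<close> by metis
    have "S \<inter> \<Inter>(F \<union> G) \<noteq> {}" using meets[of "F \<union> G"] F(1,2) G(2,3) by simp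
    moreover have "S \<inter> \<Inter>(F \<union> G) \<subseteq> S \<inter> A \<inter> \<Inter>F"
      using G(4) unfolding Inter_Un_distrib by fast
    ultimately show False using F(3) by simp
  qed
  show ?thesis unfolding beta_def
  proof (intro CollectI conjI ballI allI impI)
    show "U \<subseteq> Pow S" by (fact sub)
    show "S \<in> U" using memI[of S "{}"] by simp
    show "{} \<notin> U" using meets[of "{{}}"] by auto
    show "A \<inter> A' \<in> U" if "A \<in> U" "A' \<in> U" for A A'
      using that sub memI[of "A \<inter> A'" "{A, A'}"] by auto
    show "A' \<in> U" if "A \<in> U" "A \<subseteq> A' \<and> A' \<subseteq> S" for A A'
      using that memI[of A' "{A}"] by auto
    show "A \<in> U \<or> S - A \<in> U" if "A \<subseteq> S" for A
    proof (rule disjCI)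
      assume "S - A \<notin> U"
      \<comment> \<open>An intersection that misses \<open>S - A\<close> lies inside
        \<open>A\<close>.\<close>
      then obtain F where F: "finite F" "F \<subseteq> U" "S \<inter> (S - A) \<inter> \<Inter>F = {}"
        using avoid[of "S - A"] by auto
      have "S \<inter> \<Inter>F \<subseteq> A" using F(3) by fast
      then show "A \<in> U" using memI[OF that F(1,2)] by simp
    qed
  qed
qed

lemma fip_extends_to_ultrafilter:
  assumes "fip S G"
  obtains p where "p \<in> beta S" "G \<subseteq> p"
proof -
  have "\<exists>U\<in>{H. fip S H \<and> G \<subseteq> H}. \<forall>H\<in>{H. fip S H \<and> G \<subseteq> H}. U \<subseteq> H \<longrightarrow> H = U"
  proof (rule subset_Zorn_nonempty)
    show "{H. fip S H \<and> G \<subseteq> H} \<noteq> {}" using assms by blast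
    fix C assume C: "C \<noteq> {}" "subset.chain {H. fip S H \<and> G \<subseteq> H} C"
    then have "subset.chain {H. fip S H} C" unfolding subset.chain_def by blast
    then have "fip S (\<Union>C)" using C(1) fip_Union_chain by blast
    then show "\<Union>C \<in> {H. fip S H \<and> G \<subseteq> H}"
      using C unfolding subset.chain_def by blast
  qed
  then obtain U where U: "U \<in> {H. fip S H \<and> G \<subseteq> H}"
    and max: "\<forall>H\<in>{H. fip S H \<and> G \<subseteq> H}. U \<subseteq> H \<longrightarrow> H = U"
    by (rule bexE)
  have "U \<in> beta S"
  proof (rule maximal_fip_in_beta)
    show "fip S U" using U by simp
    show "H = U" if "fip S H" "U \<subseteq> H" for H using that U max by auto
  qed
  moreover have "G \<subseteq> U" using U by simp
  ultimately show thesis by (rule that)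
qed

text \<open>Directedness puts a single nonempty member of \<open>G\<close> below every finite
  intersection, which gives the finite intersection property.\<close>

lemma filter_base_extends_to_ultrafilter:
  assumes "G \<noteq> {}" "G \<subseteq> Pow S" "{} \<notin> G"
    and dir: "\<And>A A'. A \<in> G \<Longrightarrow> A' \<in> G \<Longrightarrow> \<exists>C\<in>G. C \<subseteq> A \<inter> A'"
  obtains p where "p \<in> beta S" "G \<subseteq> p"
proof -
  have base: "\<exists>C\<in>G. C \<subseteq> \<Inter>F" if "finite F" "F \<subseteq> G" for F
    using that
  proof (induction F rule: finite_induct)
    case empty
    then show ?case using assms(1) by auto
  next
    case (insert A F)
    then obtain C where "C \<in> G" "C \<subseteq> \<Inter>F" by auto
    moreover obtain C' where "C' \<in> G" "C' \<subseteq> A \<inter> C"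
      using dir[OF _ \<open>C \<in> G\<close>, of A] insert.prems by auto
    ultimately show ?case by (intro bexI[of _ C']) auto
  qed
  have "fip S G" unfolding fip_def
  proof (intro conjI allI impI)
    fix F assume "finite F \<and> F \<subseteq> G"
    then obtain C where C: "C \<in> G" "C \<subseteq> \<Inter>F" using base by meson
    then have "C \<subseteq> S" "C \<noteq> {}" using assms(2,3) by auto
    then show "S \<inter> \<Inter>F \<noteq> {}" using C(2) by blast
  qed (fact assms(2))
  then show thesis by (rule fip_extends_to_ultrafilter) (rule that)
qed

lemma betaD:
  assumes "p \<in> beta S"
  shows "S \<in> p" "{} \<notin> p"
    "\<forall>A\<in>p. \<forall>B\<in>p. A \<inter> B \<in> p"
    "\<forall>A\<in>p. \<forall>B. A \<subseteq> B \<and> B \<subseteq> S \<longrightarrow> B \<in> p"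
    "\<forall>A. A \<subseteq> S \<longrightarrow> A \<in> p \<or> S - A \<in> p"
  using assms unfolding beta_def by simp_all

lemma beta_superset:
  assumes "p \<in> beta S" "A \<in> p" "A \<subseteq> B" "B \<subseteq> S"
  shows "B \<in> p"
  using betaD(4)[OF assms(1)] assms(2-4) by simp

lemma beta_Int:
  assumes "p \<in> beta S" "A \<in> p" "B \<in> p"
  shows "A \<inter> B \<in> p"
  using betaD(3)[OF assms(1)] assms(2,3) by simp

lemma beta_compl:
  assumes "p \<in> beta S" "A \<subseteq> S"
  shows "S - A \<in> p \<longleftrightarrow> A \<notin> p"
proof
  assume *: "S - A \<in> p"
  show "A \<notin> p"
  proof
    assume "A \<in> p"
    then have "A \<inter> (S - A) \<in> p" by (rule beta_Int[OF assms(1) _ *])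
    then show False using betaD(2)[OF assms(1)] unfolding Diff_disjoint by simp
  qed
next
  assume "A \<notin> p"
  then show "S - A \<in> p" using betaD(5)[OF assms(1)] assms(2) by metis
qed

subsection \<open>The semigroup of ultrafilters near zero\<close>

text \<open>Membership of \<open>A\<close> in the sum means that \<open>R A\<close> is in
  \<open>p\<close>. The operator \<open>R\<close> is monotone and respects intersections and
  complements up to an inclusion; since \<open>p\<close> is upward closed, its ultrafilter axioms
  carry over to the sum.\<close>

lemma uf_plus_in_beta:
  assumes add: "\<forall>x\<in>S. \<forall>y\<in>S. x + y \<in> S" and p: "p \<in> beta S" and q: "q \<in> beta S"
  shows "uf_plus S p q \<in> beta S"
proof -
  define R where "R A = {x \<in> S. {y \<in> S. x + y \<in> A} \<in> q}" for A
  have mem: "A \<in> uf_plus S p q \<longleftrightarrow> A \<subseteq> S \<and> R A \<in> p" for A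
    unfolding uf_plus_def R_def by simp
  have top: "S \<in> p" "S \<in> q" and bot: "{} \<notin> p" "{} \<notin> q"
    using p q by (simp_all add: betaD)
  have RS: "R S = S" unfolding R_def using add top(2) by (auto cong: conj_cong)
  have R0: "R {} = {}" unfolding R_def using bot(2) by simp
  have mono: "R A \<subseteq> R A'" if "A \<subseteq> A'" for A A'
  proof
    fix x assume "x \<in> R A"
    then have "x \<in> S" "{y \<in> S. x + y \<in> A} \<in> q" unfolding R_def by auto
    moreover have "{y \<in> S. x + y \<in> A'} \<in> q"
      by (rule beta_superset[OF q calculation(2)]) (use that in auto)
    ultimately show "x \<in> R A'" unfolding R_def by simp
  qed
  have RInt: "R A \<inter> R A' \<subseteq> R (A \<inter> A')" for A A'
  proof
    fix x assume "x \<in> R A \<inter> R A'"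
    then have "x \<in> S" "{y \<in> S. x + y \<in> A} \<inter> {y \<in> S. x + y \<in> A'} \<in> q"
      unfolding R_def using beta_Int[OF q] by auto
    moreover have "{y \<in> S. x + y \<in> A \<inter> A'} \<in> q"
      by (rule beta_superset[OF q calculation(2)]) auto
    ultimately show "x \<in> R (A \<inter> A')" unfolding R_def by simp
  qed
  have Rcompl: "S - R A \<subseteq> R (S - A)" for A
  proof
    fix x assume x: "x \<in> S - R A"
    then have "S - {y \<in> S. x + y \<in> A} \<in> q"
      using beta_compl[OF q, of "{y \<in> S. x + y \<in> A}"] unfolding R_def by simp
    \<comment> \<open>Closure under addition keeps \<open>x + y\<close> in \<open>S\<close>, so
      falling outside \<open>A\<close> means falling into \<open>S - A\<close>.\<close>
    moreover have "S - {y \<in> S. x + y \<in> A} = {y \<in> S. x + y \<in> S - A}"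
      using add x by auto
    ultimately show "x \<in> R (S - A)" using x unfolding R_def by simp
  qed
  have RsubS: "R A \<subseteq> S" for A unfolding R_def by blast
  show ?thesis unfolding beta_def
  proof (intro CollectI conjI ballI allI impI)
    show "uf_plus S p q \<subseteq> Pow S" using mem by auto
    show "S \<in> uf_plus S p q" using mem RS top(1) by simp
    show "{} \<notin> uf_plus S p q" using mem R0 bot(1) by simp
    show "A \<inter> A' \<in> uf_plus S p q" if "A \<in> uf_plus S p q" "A' \<in> uf_plus S p q" for A A'
    proof -
      have "R A \<inter> R A' \<in> p" using that mem beta_Int[OF p] by simp
      then have "R (A \<inter> A') \<in> p" by (rule beta_superset[OF p _ RInt RsubS])
      then show ?thesis using that(1) mem by auto
    qed
    show "A' \<in> uf_plus S p q" if "A \<in> uf_plus S p q" "A \<subseteq> A' \<and> A' \<subseteq> S" for A A'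
      using that mem beta_superset[OF p _ mono[of A A'] RsubS] by simp
    show "A \<in> uf_plus S p q \<or> S - A \<in> uf_plus S p q" if "A \<subseteq> S" for A
    proof (rule disjCI)
      assume "S - A \<notin> uf_plus S p q"
      then have "R (S - A) \<notin> p" using mem by auto
      then have "S - R A \<notin> p" using beta_superset[OF p _ Rcompl RsubS] by auto
      then show "A \<in> uf_plus S p q" using beta_compl[OF p RsubS] mem that by simp
    qed
  qed
qed

text \<open>Both sides unfold to the same nested membership condition once
  \<open>(x + y) + z\<close> is rewritten as \<open>x + (y + z)\<close>; closure under addition
  discharges the side conditions that the sums lie in \<open>S\<close>.\<close>

lemma uf_plus_assoc:
  assumes "\<forall>x\<in>S. \<forall>y\<in>S. x + y \<in> S"
  shows "uf_plus S (uf_plus S p q) r = uf_plus S p (uf_plus S q r)"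
proof -
  have "{y \<in> S. x + y \<in> {u \<in> S. {z \<in> S. u + z \<in> A} \<in> r}} =
        {y \<in> S. {z \<in> S. y + z \<in> {w \<in> S. x + w \<in> A}} \<in> r}" if "x \<in> S" for x A
  proof -
    have "{z \<in> S. (x + y) + z \<in> A} = {z \<in> S. y + z \<in> {w \<in> S. x + w \<in> A}}" if "y \<in> S" for y
      using assms that by (auto simp: add.assoc)
    then show ?thesis using assms that by auto
  qed
  then show ?thesis
    unfolding uf_plus_def by (auto cong: conj_cong)
qed

lemma uf_plus_in_O_plus:
  assumes S: "S \<subseteq> {0<..}" and add: "\<forall>x\<in>S. \<forall>y\<in>S. x + y \<in> S"
    and p: "p \<in> O_plus S" and q: "q \<in> O_plus S"
  shows "uf_plus S p q \<in> O_plus S"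
proof -
  have pb: "p \<in> beta S" and qb: "q \<in> beta S" using p q unfolding O_plus_def by auto
  have "{0<..<\<epsilon>} \<inter> S \<in> uf_plus S p q" if "\<epsilon> > 0" for \<epsilon> :: real
  proof -
    \<comment> \<open>Two summands below half of \<epsilon> have a sum below \<epsilon>.\<close>
    have half: "{0<..<\<epsilon>/2} \<inter> S \<in> p" "{0<..<\<epsilon>/2} \<inter> S \<in> q"
      using p q that unfolding O_plus_def by auto
    have "{y \<in> S. x + y \<in> {0<..<\<epsilon>} \<inter> S} \<in> q" if "x \<in> {0<..<\<epsilon>/2} \<inter> S" for x
      by (rule beta_superset[OF qb half(2)]) (use that S add in auto)
    then have "{x \<in> S. {y \<in> S. x + y \<in> {0<..<\<epsilon>} \<inter> S} \<in> q} \<in> p"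
      by (intro beta_superset[OF pb half(1)]) auto
    then show ?thesis unfolding uf_plus_def by simp
  qed
  then show ?thesis unfolding O_plus_def using uf_plus_in_beta[OF add pb qb] by blast
qed

section \<open>Left ideals and thickness near zero\<close>

lemma left_ideal_translates:
  assumes "S \<subseteq> {0<..}" "\<forall>x\<in>S. \<forall>y\<in>S. x + y \<in> S" "p \<in> O_plus S"
  shows "left_ideal (uf_plus S) (O_plus S) ((\<lambda>r. uf_plus S r p) ` O_plus S)"
  unfolding left_ideal_def
proof (intro conjI ballI)
  show "(\<lambda>r. uf_plus S r p) ` O_plus S \<noteq> {}" using assms(3) by auto
  show "(\<lambda>r. uf_plus S r p) ` O_plus S \<subseteq> O_plus S"
    using uf_plus_in_O_plus[OF assms(1,2) _ assms(3)] by auto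
  fix r u assume r: "r \<in> O_plus S" and "u \<in> (\<lambda>r. uf_plus S r p) ` O_plus S"
  then obtain s where s: "s \<in> O_plus S" "u = uf_plus S s p" by auto
  \<comment> \<open>Associativity absorbs \<open>r\<close> into the left factor, so the result is
    again a translate of \<open>p\<close>.\<close>
  then have "uf_plus S r u = uf_plus S (uf_plus S r s) p"
    by (simp add: uf_plus_assoc[OF assms(2)])
  then show "uf_plus S r u \<in> (\<lambda>r. uf_plus S r p) ` O_plus S"
    using uf_plus_in_O_plus[OF assms(1,2) r s(1)] by simp
qed

text \<open>The compactness argument: if every finite \<open>F\<close> and every \<delta> failed,
  the exceptional sets would form a filter base. An ultrafilter \<open>p\<close> containing them is
  near zero, and all sums \<open>r + p\<close> with \<open>r\<close> in \<open>O_plus S\<close>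
  contain \<open>T\<close>; these sums form a left ideal, so \<open>T\<close> would be
  thick.\<close>

lemma not_thick_near_zero_cover:
  assumes S: "S \<subseteq> {0<..}" and add: "\<forall>x\<in>S. \<forall>y\<in>S. x + y \<in> S"
    and T: "T \<subseteq> S" and not_thick: "\<not> thick_near_zero S T" and "\<eta> > 0"
  obtains F \<delta> where "finite F" "F \<subseteq> {t \<in> S. t < \<eta>}" "\<delta> > 0"
    "\<And>y. y \<in> S \<Longrightarrow> y < \<delta> \<Longrightarrow> \<exists>t\<in>F. t + y \<notin> T"
proof (rule ccontr)
  note that' = that
  assume "\<not> thesis"
  then have ex: "\<exists>y\<in>S. y < \<delta> \<and> (\<forall>t\<in>F. t + y \<in> T)"
    if "finite F" "F \<subseteq> {t \<in> S. t < \<eta>}" "\<delta> > 0" for F \<delta>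
    using \<open>\<not> thesis\<close> that'[of F \<delta>] that by meson
  \<comment> \<open>\<open>X F \<delta>\<close> collects the points at which the desired cover
    fails; \<open>ex\<close> says that it is never empty.\<close>
  define X where "X F \<delta> = {y \<in> S. y < \<delta> \<and> (\<forall>t\<in>F. t + y \<in> T)}" for F \<delta>
  define G where "G = {X F \<delta> |F \<delta>. finite F \<and> F \<subseteq> {t \<in> S. t < \<eta>} \<and> \<delta> > 0}"
  have XG: "X F \<delta> \<in> G" if "finite F" "F \<subseteq> {t \<in> S. t < \<eta>}" "\<delta> > 0" for F \<delta>
    using that unfolding G_def by blast
  obtain p where p: "p \<in> beta S" and Gp: "G \<subseteq> p"
  proof (rule filter_base_extends_to_ultrafilter)
    show "G \<noteq> {}" using XG[of "{}" 1] by auto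
    show "G \<subseteq> Pow S" unfolding G_def X_def by blast
    show "{} \<notin> G" unfolding G_def X_def using ex by blast
    fix A A' assume "A \<in> G" "A' \<in> G"
    then obtain F \<delta> F' \<delta>' where
      "A = X F \<delta>" "finite F" "F \<subseteq> {t \<in> S. t < \<eta>}" "\<delta> > 0"
      "A' = X F' \<delta>'" "finite F'" "F' \<subseteq> {t \<in> S. t < \<eta>}" "\<delta>' > 0"
      unfolding G_def by blast
    then show "\<exists>C\<in>G. C \<subseteq> A \<inter> A'"
      \<comment> \<open>Enlarging \<open>F\<close> and shrinking \<delta> both shrink
        \<open>X\<close>, so the union and the minimum give a common refinement.\<close>
      by (intro bexI[of _ "X (F \<union> F') (min \<delta> \<delta>')"] XG) (auto simp: X_def)
  qed
  have "{0<..<\<epsilon>} \<inter> S \<in> p" if "\<epsilon> > 0" for \<epsilon>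
  proof -
    \<comment> \<open>With no translates to test, \<open>X\<close> is just an initial interval of
      \<open>S\<close>, which places \<open>p\<close> near zero.\<close>
    have "X {} \<epsilon> = {0<..<\<epsilon>} \<inter> S" unfolding X_def using S by auto
    then show ?thesis using XG[of "{}" \<epsilon>] that Gp by auto
  qed
  then have pO: "p \<in> O_plus S" using p unfolding O_plus_def by blast
  have "T \<in> uf_plus S r p" if r: "r \<in> O_plus S" for r
  proof -
    have rb: "r \<in> beta S" and small: "{0<..<\<eta>} \<inter> S \<in> r"
      using r \<open>\<eta> > 0\<close> unfolding O_plus_def by auto
    have "{y \<in> S. x + y \<in> T} \<in> p" if "x \<in> {0<..<\<eta>} \<inter> S" for x
      \<comment> \<open>A single translate \<open>x\<close> is tested; the bound 1 is an arbitrary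
        positive number.\<close>
      by (rule beta_superset[OF p, of "X {x} 1"]) (use that XG[of "{x}" 1] Gp in \<open>auto simp: X_def\<close>)
    then have "{x \<in> S. {y \<in> S. x + y \<in> T} \<in> p} \<in> r"
      by (intro beta_superset[OF rb small]) auto
    then show ?thesis using T unfolding uf_plus_def by simp
  qed
  then have "(\<lambda>r. uf_plus S r p) ` O_plus S \<subseteq> uf_closure S T"
    using uf_plus_in_O_plus[OF S add _ pO] unfolding uf_closure_def O_plus_def by auto
  then have "thick_near_zero S T"
    unfolding thick_near_zero_def using T left_ideal_translates[OF S add pO] by blast
  then show False using not_thick by blast
qed

subsection \<open>The block matrix\<close>

text \<open>Writing the support through the injections lets the sum in \<open>mat_vec\<close> split
  off the first column and be reindexed by the columns of \<open>B\<close>.\<close>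

lemma block_matrix_support_Inl:
  fixes B :: "'a \<Rightarrow> 'd \<Rightarrow> real" and M :: "'g \<Rightarrow> 'm \<Rightarrow> real"
  shows "{j. block_matrix B M (Inl i) j \<noteq> 0} = insert (Inl ()) ((Inr \<circ> Inl) ` {j. B i j \<noteq> 0})"
proof (rule set_eqI)
  fix j show "j \<in> {j. block_matrix B M (Inl i) j \<noteq> 0} \<longleftrightarrow>
      j \<in> insert (Inl ()) ((Inr \<circ> Inl) ` {j. B i j \<noteq> 0})"
    by (cases "(B, M, Inl i :: 'a + 'g, j)" rule: block_matrix.cases) auto
qed

lemma block_matrix_support_Inr:
  fixes B :: "'a \<Rightarrow> 'd \<Rightarrow> real" and M :: "'g \<Rightarrow> 'm \<Rightarrow> real"
  shows "{j. block_matrix B M (Inr l) j \<noteq> 0} = (Inr \<circ> Inr) ` {k. M l k \<noteq> 0}"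
proof (rule set_eqI)
  fix j show "j \<in> {j. block_matrix B M (Inr l) j \<noteq> 0} \<longleftrightarrow>
      j \<in> (Inr \<circ> Inr) ` {k. M l k \<noteq> 0}"
    by (cases "(B, M, Inr l :: 'a + 'g, j)" rule: block_matrix.cases) auto
qed

lemma admissible_block_matrix:
  assumes B: "admissible B" and M: "admissible M"
  shows "admissible (block_matrix B M)"
  unfolding admissible_def
proof (intro conjI allI)
  fix i j
  show "block_matrix B M i j \<in> \<rat>"
    using B M unfolding admissible_def
    by (cases "(B, M, i, j)" rule: block_matrix.cases) auto
next
  fix i
  show "finite {j. block_matrix B M i j \<noteq> 0}"
    using B M unfolding admissible_def
    by (cases i) (auto simp only: block_matrix_support_Inl block_matrix_support_Inr
        finite_insert finite_imageI)
  \<comment> \<open>A row through \<open>B\<close> has the entry 1 in the first column; a row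
    through \<open>M\<close> has a nonzero entry of \<open>M\<close>.\<close>
  have "{j. block_matrix B M i j \<noteq> 0} \<noteq> {}"
    using M unfolding admissible_def
    by (cases i) (auto simp only: block_matrix_support_Inl block_matrix_support_Inr)
  then show "\<exists>j. block_matrix B M i j \<noteq> 0" by blast
qed

lemma mat_vec_block_matrix_Inl:
  assumes "admissible B"
  shows "mat_vec (block_matrix B M) z (Inl i) = z (Inl ()) + mat_vec B (z \<circ> Inr \<circ> Inl) i"
proof -
  have fin: "finite {j. B i j \<noteq> 0}" using assms unfolding admissible_def by blast
  show ?thesis
    unfolding mat_vec_def block_matrix_support_Inl
    by (subst sum.insert) (auto simp: fin sum.reindex inj_on_def)
qed

lemma mat_vec_block_matrix_Inr:
  "mat_vec (block_matrix B M) z (Inr l) = mat_vec M (z \<circ> Inr \<circ> Inr) l"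
  unfolding mat_vec_def block_matrix_support_Inr
  by (auto simp: sum.reindex inj_on_def)

text \<open>The translate chosen by \<open>cover\<close> varies with \<open>y\<close>. Recording it
  in the colour, next to the old colour of the translated point, forces one common translate along a
  monochromatic image of \<open>B\<close>.\<close>

lemma ipr_near_zero_finite_translates:
  assumes add: "\<forall>x\<in>S. \<forall>y\<in>S. x + y \<in> S"
    and B: "ipr_near_zero S B" and \<phi>: "finite_colouring \<phi> S"
    and F: "finite F" "F \<subseteq> S" and "\<delta> > 0"
    and cover: "\<And>y. y \<in> S \<Longrightarrow> y < \<delta> \<Longrightarrow> \<exists>t\<in>F. P (t + y)"
  obtains t x c where "t \<in> F" "\<And>j. x j \<in> S"
    "\<And>i. mat_vec B x i \<in> S" "\<And>i. mat_vec B x i < \<delta>"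
    "\<And>i. P (t + mat_vec B x i)" "\<And>i. \<phi> (t + mat_vec B x i) = c"
proof -
  obtain \<tau> where \<tau>: "\<And>y. y \<in> S \<Longrightarrow> y < \<delta> \<Longrightarrow> \<tau> y \<in> F \<and> P (\<tau> y + y)"
    using cover by metis
  \<comment> \<open>Colours are natural numbers, so the translates in \<open>F\<close> are numbered
    before being paired with old colours.\<close>
  obtain e :: "real \<Rightarrow> nat" where e: "inj_on e F"
    using F(1) finite_imp_inj_to_nat_seg by blast
  \<comment> \<open>The default 0 may coincide with the code of a pair; no confusion arises, because
    the image of \<open>B\<close> is taken below \<delta>.\<close>
  define \<psi> where
    "\<psi> y = (if y < \<delta> then prod_encode (e (\<tau> y), \<phi> (\<tau> y + y)) else 0)" for y
  have "\<psi> ` S \<subseteq> insert 0 (prod_encode ` (e ` F \<times> \<phi> ` S))"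
  proof
    fix n assume "n \<in> \<psi> ` S"
    then obtain y where y: "y \<in> S" "n = \<psi> y" by auto
    show "n \<in> insert 0 (prod_encode ` (e ` F \<times> \<phi> ` S))"
    proof (cases "y < \<delta>")
      case True
      then have "\<tau> y \<in> F" "\<tau> y + y \<in> S" using \<tau>[OF y(1)] y(1) F(2) add by auto
      then show ?thesis using y(2) True unfolding \<psi>_def by auto
    qed (use y in \<open>simp add: \<psi>_def\<close>)
  qed
  moreover have "finite \<dots>" using F(1) \<phi> unfolding finite_colouring_def by simp
  ultimately have "finite_colouring \<psi> S"
    unfolding finite_colouring_def using finite_subset by blast
  then obtain x where xS: "\<forall>j. x j \<in> S"
    and mono: "monochromatic \<psi> S (mat_vec B x)"
    and small: "\<forall>i. mat_vec B x i \<in> {-\<delta><..<\<delta>}"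
    using B \<open>\<delta> > 0\<close> unfolding ipr_near_zero_def by meson
  define v where "v = mat_vec B x"
  obtain c where c: "\<And>i. v i \<in> S" "\<And>i. \<psi> (v i) = c"
    using mono unfolding monochromatic_def v_def by auto
  have v: "v i < \<delta>" "\<tau> (v i) \<in> F" "P (\<tau> (v i) + v i)" for i
    using small \<tau>[OF c(1)] unfolding v_def by auto
  have same: "\<tau> (v i) = \<tau> (v i')" "\<phi> (\<tau> (v i) + v i) = \<phi> (\<tau> (v i') + v i')" for i i'
  proof -
    have "\<psi> (v i) = \<psi> (v i')" using c(2) by simp
    then show "\<tau> (v i) = \<tau> (v i')" "\<phi> (\<tau> (v i) + v i) = \<phi> (\<tau> (v i') + v i')"
      \<comment> \<open>Both entries are below \<delta>, so both colours are genuine codes, and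
        decoding recovers the translate because \<open>e\<close> is injective on
        \<open>F\<close>.\<close>
      using v e unfolding \<psi>_def by (auto simp: inj_on_eq_iff)
  qed
  \<comment> \<open>\<open>undefined\<close> serves as an arbitrary row; row types are
    nonempty.\<close>
  define t where "t = \<tau> (v undefined)"
  have t: "\<tau> (v i) = t" for i unfolding t_def by (rule same(1))
  show thesis
  proof (rule that[of t x])
    show "t \<in> F" using v(2) unfolding t_def .
    show "x j \<in> S" for j using xS by blast
    show "mat_vec B x i \<in> S" "mat_vec B x i < \<delta>" for i
      using c(1)[of i] v(1)[of i] unfolding v_def by simp_all
    show "P (t + mat_vec B x i)" for i
      using v(3)[of i, unfolded t] unfolding v_def .
    show "\<phi> (t + mat_vec B x i) = \<phi> (t + v undefined)" for i
      using same(2)[of i undefined, unfolded t] unfolding v_def .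
  qed
qed

theorem theorem3p19:
  fixes S :: "real set"
    and B :: "'a::countable \<Rightarrow> 'd::countable \<Rightarrow> real"
    and M :: "'g::countable \<Rightarrow> 'm::countable \<Rightarrow> real"
  assumes "S \<subseteq> {0<..}"
    and "\<forall>x\<in>S. \<forall>y\<in>S. x + y \<in> S"
    and "{0<..} \<subseteq> closure S"
    and "ipr_near_zero S B"
    and "M \<in> M0 S"
  shows "ipr_near_zero S (block_matrix B M)"
proof -
  have admB: "admissible B" and admM: "admissible M"
    using assms(4,5) unfolding ipr_near_zero_def M0_def by auto
  have "\<exists>z. (\<forall>j. z j \<in> S) \<and> monochromatic \<phi> S (mat_vec (block_matrix B M) z) \<and>
            (\<forall>i. mat_vec (block_matrix B M) z i \<in> {-\<epsilon><..<\<epsilon>})"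
    if \<phi>: "finite_colouring \<phi> S" and "\<epsilon> > 0" for \<phi> and \<epsilon> :: real
  proof -
    define good where "good c \<longleftrightarrow> (\<exists>x0 x. x0 \<in> S \<and> (\<forall>j. x j \<in> S) \<and>
      (\<forall>i. x0 + mat_vec B x i \<in> {s \<in> S. s < \<epsilon> \<and> \<phi> s = c}))" for c
    define T where "T = {s \<in> S. s < \<epsilon> \<and> good (\<phi> s)}"
    have "thick_near_zero S T"
    proof (rule ccontr)
      assume not_thick: "\<not> thick_near_zero S T"
      have "T \<subseteq> S" unfolding T_def by blast
      \<comment> \<open>Half of \<epsilon> is reserved for the translate and half for the image of
        \<open>B\<close>, so that their sums stay below \<epsilon>.\<close>
      obtain F \<delta> where F: "finite F" "F \<subseteq> {t \<in> S. t < \<epsilon> / 2}" and "\<delta> > 0"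
        and cover: "\<And>y. y \<in> S \<Longrightarrow> y < \<delta> \<Longrightarrow> \<exists>t\<in>F. t + y \<notin> T"
        using not_thick_near_zero_cover[OF assms(1,2) \<open>T \<subseteq> S\<close> not_thick half_gt_zero[OF \<open>\<epsilon> > 0\<close>]]
        by metis
      obtain t x c where t: "t \<in> F" and x: "\<And>j. x j \<in> S"
        and v: "\<And>i. mat_vec B x i \<in> S" "\<And>i. mat_vec B x i < min \<delta> (\<epsilon> / 2)"
        and notT: "\<And>i. t + mat_vec B x i \<notin> T"
        and c: "\<And>i. \<phi> (t + mat_vec B x i) = c"
        by (rule ipr_near_zero_finite_translates[OF assms(2,4) \<phi> F(1),
              of "min \<delta> (\<epsilon> / 2)" "\<lambda>s. s \<notin> T"])
          (use F \<open>\<delta> > 0\<close> \<open>\<epsilon> > 0\<close> cover in auto)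
      have tS: "t \<in> S" "t < \<epsilon> / 2" using t F(2) by auto
      have in_S: "t + mat_vec B x i \<in> S" "t + mat_vec B x i < \<epsilon>" for i
        using assms(2) v(1)[of i] v(2)[of i] tS by auto
      \<comment> \<open>The translate \<open>t\<close> plays the part of \<open>x0\<close>. An
        arbitrary row then yields a point below \<epsilon> of good colour that avoids
        \<open>T\<close>, against the definition of \<open>T\<close>.\<close>
      have "good c" unfolding good_def using tS(1) x in_S c by blast
      then show False using notT[of undefined] in_S[of undefined] c[of undefined] unfolding T_def by simp
    qed
    moreover have "finite_colouring \<phi> T"
      using \<phi> finite_subset[of "\<phi> ` T" "\<phi> ` S"] unfolding finite_colouring_def T_def by blast
    ultimately obtain y where y: "\<And>k. y k \<in> S" and "monochromatic \<phi> T (mat_vec M y)"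
      using assms(5) unfolding M0_def by blast
    then obtain c where c: "\<And>l. mat_vec M y l \<in> T" "\<And>l. \<phi> (mat_vec M y l) = c"
      unfolding monochromatic_def by blast
    \<comment> \<open>Any row of \<open>M\<close> will do: its entry lies in \<open>T\<close>, so
      the common colour is good.\<close>
    then have "good c" using c[of undefined] unfolding T_def by simp
    then obtain x0 x where x0: "x0 \<in> S" and x: "\<And>j. x j \<in> S"
      and Bx: "\<And>i. x0 + mat_vec B x i \<in> {s \<in> S. s < \<epsilon> \<and> \<phi> s = c}"
      unfolding good_def by blast
    \<comment> \<open>Goodness supplies \<open>x0\<close> and \<open>x\<close> for the very colour
      \<open>c\<close> attained by \<open>M\<close>, so the concatenated vector makes both blocks of
      rows agree in colour.\<close>
    define z where "z = case_sum (\<lambda>_::unit. x0) (case_sum x y)"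
    have z: "z (Inl ()) = x0" "z \<circ> Inr \<circ> Inl = x" "z \<circ> Inr \<circ> Inr = y"
      unfolding z_def by auto
    have entries: "mat_vec (block_matrix B M) z i \<in> {s \<in> S. s < \<epsilon> \<and> \<phi> s = c}" for i
      using Bx c unfolding T_def
      by (cases i) (auto simp: mat_vec_block_matrix_Inl[OF admB] mat_vec_block_matrix_Inr z)
    have "z j \<in> S" for j using x0 x y unfolding z_def by (auto split: sum.split)
    moreover have "monochromatic \<phi> S (mat_vec (block_matrix B M) z)"
      unfolding monochromatic_def using entries by blast
    moreover have "mat_vec (block_matrix B M) z i \<in> {-\<epsilon><..<\<epsilon>}" for i
    proof -
      \<comment> \<open>Entries lie in \<open>S\<close> and are therefore positive, which settles
        the lower bound.\<close>
      have "mat_vec (block_matrix B M) z i > 0" using entries[of i] assms(1) by auto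
      then show ?thesis using entries[of i] \<open>\<epsilon> > 0\<close> by simp
    qed
    ultimately show ?thesis by blast
  qed
  then show ?thesis
    unfolding ipr_near_zero_def using admissible_block_matrix[OF admB admM] by blast
qed

end
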